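(* There exists a sequence $(G_n,\lambda_n)_{n\in\mathbb{N}}$ of finite normed groups such that for every normed topological group $(H,\rho)$, every $\varepsilon>0$ and every finite subset $F\subseteq H$ there exists $i_0\in\mathbb{N}$ such that for all $i\geq i_0$ there is an $\varepsilon$-homomorphism $\phi:F\rightarrow G_i$. Moreover, one may require that $\phi$ satisfies, for every $f\in F$, the inequality $\Gamma_{\phi(f)}^{G_i}(r)\leq 2\Gamma_f^H(r)+\varepsilon r$ for all $r\in[0,\infty)$, where $\Gamma_{\phi(f)}^{G_i}$ and $\Gamma_f^H$ are the minimal moduli of continuity of $\phi(f)$ in $(G_i,\lambda_i)$ and of $f$ in $(H,\rho)$ respectively.
   Context: A norm on a group $G$ is a function $\lambda:G\to[0,\infty)$ with $\lambda(x)=\lambda(x^{-1})$, $\lambda(xy)\leq\lambda(x)+\lambda(y)$ for all $x,y\in G$, and $\lambda(x)=0$ iff $x=1_G$. Norms correspond bijectively to left-invariant metrics via $d(x,y)=\lambda(x^{-1}y)$, $\lambda(x)=d(x,1_G)$. A normed group is a group with a norm. A norm $\lambda$ is continuous if for every $x\in G$ and $\varepsilon>0$ there is $\delta>0$ such that for all $y\in G$, $\lambda(y)<\delta$ implies $\lambda(x^{-1}yx)<\varepsilon$ (equivalently, the metric topology makes $G$ a topological group). A normed topological group is a group with a continuous norm. For a group $G$ with a continuous norm $\lambda$ and $x\in G$, the minimal modulus of continuity of $x$ in $G$ is the function $\Gamma_x^G:[0,\infty)\to[0,\infty)$, $$\Gamma_x^G(r)=\max\bigl\{r,\ \sup\{\lambda(x^{\eta}\cdot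 g\cdot x^{-\eta}): g\in G,\ \lambda(g)\leq r,\ \eta\in\{1,-1\}\}\bigr\}.$$ Let $(G,\lambda)$ and $(K,\rho)$ be normed groups, $F\subseteq G$ a finite subset and $\varepsilon>0$. A map $\phi:F\to K$ is an $\varepsilon$-homomorphism if (i) $\rho(\phi(gh)^{-1}\phi(g)\phi(h))<\varepsilon$ for all $g,h\in F$ with $gh\in F$; and (ii) $|\rho(\phi(g))-\lambda(g)|<\varepsilon$ for all $g\in F$. *)

theory Defs
  imports Complex_Main "HOL-Algebra.Group"
begin

locale normed_group = group G for G (structure) +
  fixes lam :: "'a \<Rightarrow> real"
  assumes norm_nonneg: "x \<in> carrier G \<Longrightarrow> 0 \<le> lam x"
    and norm_inv: "x \<in> carrier G \<Longrightarrow> lam (inv x) = lam x"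
    and norm_mult: "\<lbrakk>x \<in> carrier G; y \<in> carrier G\<rbrakk> \<Longrightarrow> lam (x \<otimes> y) \<le> lam x + lam y"
    and norm_eq_zero_iff: "x \<in> carrier G \<Longrightarrow> lam x = 0 \<longleftrightarrow> x = \<one>"

locale normed_topological_group = normed_group +
  assumes norm_continuous:
    "\<lbrakk>x \<in> carrier G; 0 < \<epsilon>\<rbrakk> \<Longrightarrow>
      \<exists>\<delta>>0. \<forall>y \<in> carrier G. lam y < \<delta> \<longrightarrow> lam (inv x \<otimes> y \<otimes> x) < \<epsilon>"

text \<open>
  The supremum below is taken in \<^typ>\<open>real\<close>; for \<open>r \<ge> 0\<close> it is over a nonempty bounded set,
  as is checked in the lemmas that follow.
\<close>

definition min_modulus_set :: "('a, 'm) monoid_scheme \<Rightarrow> ('a \<Rightarrow> real) \<Rightarrow> 'a \<Rightarrow> real \<Rightarrow> real set" where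
  "min_modulus_set G lam x r =
    {lam (x [^]\<^bsub>G\<^esub> \<eta> \<otimes>\<^bsub>G\<^esub> g \<otimes>\<^bsub>G\<^esub> x [^]\<^bsub>G\<^esub> (- \<eta>)) | g \<eta>.
       g \<in> carrier G \<and> lam g \<le> r \<and> \<eta> \<in> {1, - 1 :: int}}"

definition min_modulus :: "('a, 'm) monoid_scheme \<Rightarrow> ('a \<Rightarrow> real) \<Rightarrow> 'a \<Rightarrow> real \<Rightarrow> real" where
  "min_modulus G lam x r = max r (Sup (min_modulus_set G lam x r))"

lemma (in normed_group) min_modulus_set_nonempty:
  assumes "0 \<le> r"
  shows "min_modulus_set G lam x r \<noteq> {}"
proof -
  have "lam \<one> \<le> r" using norm_eq_zero_iff[of \<one>] assms by simp
  then show ?thesis unfolding min_modulus_set_def using one_closed by blast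
qed

lemma (in normed_group) min_modulus_set_bdd_above:
  assumes x: "x \<in> carrier G"
  shows "bdd_above (min_modulus_set G lam x r)"
proof (rule bdd_aboveI[where M = "r + 2 * lam x"])
  fix t assume "t \<in> min_modulus_set G lam x r"
  then obtain g \<eta> where g: "g \<in> carrier G" "lam g \<le> r"
    and \<eta>: "\<eta> = 1 \<or> \<eta> = (- 1 :: int)"
    and t: "t = lam (x [^] \<eta> \<otimes> g \<otimes> x [^] (- \<eta>))"
    unfolding min_modulus_set_def by blast
  have "lam (x [^] \<eta>) = lam x" "lam (x [^] (- \<eta>)) = lam x"
    using \<eta> x norm_inv by (auto simp: int_pow_neg)
  moreover have "x [^] \<eta> \<in> carrier G" "x [^] (- \<eta>) \<in> carrier G"
    using x by (simp_all del: int_pow_neg)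
  ultimately show "t \<le> r + 2 * lam x"
    using norm_mult[of "x [^] \<eta> \<otimes> g" "x [^] (- \<eta>)"] norm_mult[of "x [^] \<eta>" g] g t by simp
qed

definition eps_homomorphism ::
  "('a, 'm) monoid_scheme \<Rightarrow> ('a \<Rightarrow> real) \<Rightarrow> ('b, 'n) monoid_scheme \<Rightarrow> ('b \<Rightarrow> real) \<Rightarrow>
    'a set \<Rightarrow> real \<Rightarrow> ('a \<Rightarrow> 'b) \<Rightarrow> bool" where
  "eps_homomorphism G lam K rho F \<epsilon> \<phi> \<longleftrightarrow>
    (\<forall>g\<in>F. \<phi> g \<in> carrier K) \<and>
    (\<forall>g\<in>F. \<forall>h\<in>F. g \<otimes>\<^bsub>G\<^esub> h \<in> F \<longrightarrow>
      rho (inv\<^bsub>K\<^esub> (\<phi> (g \<otimes>\<^bsub>G\<^esub> h)) \<otimes>\<^bsub>K\<^esub> \<phi> g \<otimes>\<^bsub>K\<^esub> \<phi> h) < \<epsilon>) \<and>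
    (\<forall>g\<in>F. \<bar>rho (\<phi> g) - lam g\<bar> < \<epsilon>)"

text \<open>
  A single \<open>\<phi>\<close> satisfies both the \<open>\<epsilon>\<close>-homomorphism condition and the inequality of moduli.
  Every finite group has a copy with carrier in \<^typ>\<open>nat\<close>, so sequences of finite groups may be
  taken there. The group \<open>H\<close>, in contrast, may live on any type \<open>'h\<close>, and the sequence must not
  depend on \<open>'h\<close>. HOL does not quantify over types inside a formula, so a statement of the form
  ``there is a sequence such that for all \<open>H :: 'h monoid\<close> ...'' alone would allow this dependence.
  Independence is expressed by saying in addition that each sequence that works for all groups on
  \<^typ>\<open>nat\<close> works for all groups on \<open>'h\<close>: a sequence for \<^typ>\<open>nat\<close> then serves all types.
\<close>

definition finite_normed_groups :: "(nat \<Rightarrow> 'a monoid) \<Rightarrow> (nat \<Rightarrow> 'a \<Rightarrow> real) \<Rightarrow> bool" where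
  "finite_normed_groups G lam \<longleftrightarrow>
    (\<forall>n. normed_group (G n) (lam n) \<and> finite (carrier (G n)))"

definition eventually_approximates ::
  "(nat \<Rightarrow> 'a monoid) \<Rightarrow> (nat \<Rightarrow> 'a \<Rightarrow> real) \<Rightarrow> 'h monoid \<Rightarrow> ('h \<Rightarrow> real) \<Rightarrow> bool" where
  "eventually_approximates G lam H rho \<longleftrightarrow>
    (\<forall>\<epsilon>>0. \<forall>F. finite F \<and> F \<subseteq> carrier H \<longrightarrow>
      (\<exists>i\<^sub>0. \<forall>i\<ge>i\<^sub>0. \<exists>\<phi>.
        eps_homomorphism H rho (G i) (lam i) F \<epsilon> \<phi> \<and>
        (\<forall>f\<in>F. \<forall>r\<ge>0.
          min_modulus (G i) (lam i) (\<phi> f) r \<le> 2 * min_modulus H rho f r + \<epsilon> * r)))"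

end

theory Submission
  imports Defs "HOL-Algebra.Bij" "HOL-Algebra.Product_Groups" "HOL-Library.Countable_Set"
begin

text \<open>
  Left multiplication by the elements of \<open>F\<close> acts partially on a finite ball of the Cayley graph, and
  its extensions to permutations generate a finite group in which no short word is trivial unless it
  is trivial in \<open>H\<close>. An infimum over words of the norm in \<open>H\<close>, plus a small penalty affine in the
  length, gives a norm on this group; long relators are too expensive to shorten anything, and
  conjugation by a letter increases the penalty only by a factor close to 1. After rounding, the norms
  are rational, so countably many finite normed groups suffice; the products of initial segments of
  their enumeration, with the maximum norm, form the required sequence. Since only the subgroup
  generated by \<open>F\<close> matters, \<open>H\<close> may be taken to be countable.
\<close>

section \<open>Moduli of continuity and isometric homomorphisms\<close>

text \<open>The supremum runs over a nonempty bounded set, so it is at most \<open>B\<close> exactly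
  when each member is. The two exponents become conjugation by \<open>x\<close> in both directions,
  and later proofs need only this form.\<close>

lemma (in normed_group) min_modulus_le_iff:
  assumes x: "x \<in> carrier G" and r: "0 \<le> r"
  shows "min_modulus G lam x r \<le> B \<longleftrightarrow>
    r \<le> B \<and> (\<forall>g\<in>carrier G. lam g \<le> r \<longrightarrow>
      lam (x \<otimes> g \<otimes> inv x) \<le> B \<and> lam (inv x \<otimes> g \<otimes> x) \<le> B)"
proof -
  have "min_modulus_set G lam x r =
      (\<Union>g\<in>{g \<in> carrier G. lam g \<le> r}. {lam (x \<otimes> g \<otimes> inv x), lam (inv x \<otimes> g \<otimes> x)})"
    (is "_ = ?R")
  proof (intro equalityI subsetI)
    show "t \<in> ?R" if "t \<in> min_modulus_set G lam x r" for t
      using that x unfolding min_modulus_set_def by (auto simp: int_pow_neg)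
    show "t \<in> min_modulus_set G lam x r" if "t \<in> ?R" for t
    proof -
      obtain g and \<eta> :: int where "g \<in> carrier G" "lam g \<le> r" "\<eta> \<in> {1, -1}"
        "t = lam (x [^] \<eta> \<otimes> g \<otimes> x [^] (- \<eta>))"
      proof -
        obtain g where "g \<in> carrier G" "lam g \<le> r"
          "t = lam (x \<otimes> g \<otimes> inv x) \<or> t = lam (inv x \<otimes> g \<otimes> x)"
          using \<open>t \<in> ?R\<close> by blast
        then show thesis
          using that[of g 1] that[of g "-1"] x by (auto simp: int_pow_neg)
      qed
      then show ?thesis
        unfolding min_modulus_set_def by blast
    qed
  qed
  moreover have "Sup (min_modulus_set G lam x r) \<le> B \<longleftrightarrow> (\<forall>t\<in>min_modulus_set G lam x r. t \<le> B)"
    using cSup_le_iff min_modulus_set_nonempty min_modulus_set_bdd_above x r by metis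
  ultimately show ?thesis
    unfolding min_modulus_def by auto
qed

lemma (in normed_group) min_modulus_ge:
  assumes "x \<in> carrier G" "0 \<le> r"
  shows "r \<le> min_modulus G lam x r"
    and "g \<in> carrier G \<Longrightarrow> lam g \<le> r \<Longrightarrow> lam (x \<otimes> g \<otimes> inv x) \<le> min_modulus G lam x r"
    and "g \<in> carrier G \<Longrightarrow> lam g \<le> r \<Longrightarrow> lam (inv x \<otimes> g \<otimes> x) \<le> min_modulus G lam x r"
  using min_modulus_le_iff[OF assms, of "min_modulus G lam x r"] by auto

text \<open>Injectivity is not demanded: it follows because only the unit has norm 0.\<close>

definition isometric_hom ::
  "('a, 'm) monoid_scheme \<Rightarrow> ('a \<Rightarrow> real) \<Rightarrow> ('b, 'n) monoid_scheme \<Rightarrow> ('b \<Rightarrow> real) \<Rightarrow>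
    ('a \<Rightarrow> 'b) \<Rightarrow> bool" where
  "isometric_hom G lam K rho \<psi> \<longleftrightarrow>
    \<psi> \<in> hom G K \<and> (\<forall>x\<in>carrier G. rho (\<psi> x) = lam x)"

text \<open>One inequality between the moduli suffices, since the other holds for every isometric
  homomorphism between normed groups. The stated one carries upper bounds on moduli over to the
  target.\<close>

definition modulus_embedding ::
  "('a, 'm) monoid_scheme \<Rightarrow> ('a \<Rightarrow> real) \<Rightarrow> ('b, 'n) monoid_scheme \<Rightarrow> ('b \<Rightarrow> real) \<Rightarrow>
    ('a \<Rightarrow> 'b) \<Rightarrow> bool" where
  "modulus_embedding G lam K rho \<psi> \<longleftrightarrow>
    isometric_hom G lam K rho \<psi> \<and>
    (\<forall>x\<in>carrier G. \<forall>r\<ge>0. min_modulus K rho (\<psi> x) r \<le> min_modulus G lam x r)"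

lemma modulus_embedding_compose:
  assumes "modulus_embedding G lam K rho \<psi>" "modulus_embedding K rho L mu \<chi>"
  shows "modulus_embedding G lam L mu (\<chi> \<circ> \<psi>)"
  using assms unfolding modulus_embedding_def isometric_hom_def
  by (fastforce simp: hom_def Pi_iff intro: order_trans)

lemma isometric_hom_props:
  assumes G: "normed_group G lam" and K: "normed_group K rho" and \<psi>: "isometric_hom G lam K rho \<psi>"
  shows isometric_hom_closed: "x \<in> carrier G \<Longrightarrow> \<psi> x \<in> carrier K"
    and isometric_hom_mult: "x \<in> carrier G \<Longrightarrow> y \<in> carrier G \<Longrightarrow> \<psi> (x \<otimes>\<^bsub>G\<^esub> y) = \<psi> x \<otimes>\<^bsub>K\<^esub> \<psi> y"
    and isometric_hom_inv: "x \<in> carrier G \<Longrightarrow> \<psi> (inv\<^bsub>G\<^esub> x) = inv\<^bsub>K\<^esub> (\<psi> x)"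
    and isometric_hom_norm: "x \<in> carrier G \<Longrightarrow> rho (\<psi> x) = lam x"
    and isometric_hom_inj: "inj_on \<psi> (carrier G)"
proof -
  interpret G: normed_group G lam by (rule G)
  interpret K: normed_group K rho by (rule K)
  interpret group_hom G K \<psi>
    using \<psi> by unfold_locales (simp add: isometric_hom_def)
  show "x \<in> carrier G \<Longrightarrow> \<psi> x \<in> carrier K"
    "x \<in> carrier G \<Longrightarrow> y \<in> carrier G \<Longrightarrow> \<psi> (x \<otimes>\<^bsub>G\<^esub> y) = \<psi> x \<otimes>\<^bsub>K\<^esub> \<psi> y"
    "x \<in> carrier G \<Longrightarrow> \<psi> (inv\<^bsub>G\<^esub> x) = inv\<^bsub>K\<^esub> (\<psi> x)"
    by simp_all
  show norm: "x \<in> carrier G \<Longrightarrow> rho (\<psi> x) = lam x" for x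
    using \<psi> by (simp add: isometric_hom_def)
  show "inj_on \<psi> (carrier G)"
    using norm G.norm_eq_zero_iff K.norm_eq_zero_iff[of "\<one>\<^bsub>K\<^esub>"]
    unfolding inj_on_one_iff by (metis K.one_closed)
qed

text \<open>The balls of \<open>G\<close> are mapped into those of \<open>K\<close> and norms of
  conjugates are preserved, so the supremum on the right is taken over a larger set.\<close>

lemma min_modulus_isometric_hom:
  assumes G: "normed_group G lam" and K: "normed_group K rho" and \<psi>: "isometric_hom G lam K rho \<psi>"
    and x: "x \<in> carrier G" and r: "0 \<le> r"
  shows "min_modulus G lam x r \<le> min_modulus K rho (\<psi> x) r"
proof -
  interpret G: normed_group G lam by (rule G)
  interpret K: normed_group K rho by (rule K)
  note P = isometric_hom_props[OF G K \<psi>]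
  have "lam (x \<otimes>\<^bsub>G\<^esub> g \<otimes>\<^bsub>G\<^esub> inv\<^bsub>G\<^esub> x) = rho (\<psi> x \<otimes>\<^bsub>K\<^esub> \<psi> g \<otimes>\<^bsub>K\<^esub> inv\<^bsub>K\<^esub> (\<psi> x))"
    "lam (inv\<^bsub>G\<^esub> x \<otimes>\<^bsub>G\<^esub> g \<otimes>\<^bsub>G\<^esub> x) = rho (inv\<^bsub>K\<^esub> (\<psi> x) \<otimes>\<^bsub>K\<^esub> \<psi> g \<otimes>\<^bsub>K\<^esub> \<psi> x)"
    if "g \<in> carrier G" for g
    using P(4)[of "x \<otimes>\<^bsub>G\<^esub> g \<otimes>\<^bsub>G\<^esub> inv\<^bsub>G\<^esub> x"] P(4)[of "inv\<^bsub>G\<^esub> x \<otimes>\<^bsub>G\<^esub> g \<otimes>\<^bsub>G\<^esub> x"] that x by (simp_all add: P)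
  then show ?thesis
    using x r P(1,4) K.min_modulus_ge[of "\<psi> x" r] by (simp add: G.min_modulus_le_iff)
qed

section \<open>Transport of normed groups along bijections and injections\<close>

text \<open>The group laws and norm axioms of \<open>K\<close> are pulled back along the bijection.
  Since every element of a ball of \<open>K\<close> comes from \<open>G\<close>, the moduli cannot
  grow.\<close>

lemma normed_group_transport:
  assumes G: "normed_group G lam" and bij: "bij_betw \<psi> (carrier G) (carrier K)"
    and mult: "\<And>x y. x \<in> carrier G \<Longrightarrow> y \<in> carrier G \<Longrightarrow> \<psi> (x \<otimes>\<^bsub>G\<^esub> y) = \<psi> x \<otimes>\<^bsub>K\<^esub> \<psi> y"
    and one: "\<psi> \<one>\<^bsub>G\<^esub> = \<one>\<^bsub>K\<^esub>"
    and norm: "\<And>x. x \<in> carrier G \<Longrightarrow> rho (\<psi> x) = lam x"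
  shows "normed_group K rho" and "modulus_embedding G lam K rho \<psi>"
proof -
  interpret G: normed_group G lam by (rule G)
  have img: "\<exists>x\<in>carrier G. y = \<psi> x" if "y \<in> carrier K" for y
    using bij that by (auto simp: bij_betw_def)
  have cl: "\<psi> x \<in> carrier K" if "x \<in> carrier G" for x
    using bij that by (auto simp: bij_betw_def)
  have inj: "\<psi> x = \<psi> y \<longleftrightarrow> x = y" if "x \<in> carrier G" "y \<in> carrier G" for x y
    using bij that by (auto simp: bij_betw_def inj_on_def)
  interpret K: group K
  proof (rule groupI)
    show "\<one>\<^bsub>K\<^esub> \<in> carrier K" using cl one by force
    show "x \<otimes>\<^bsub>K\<^esub> y \<in> carrier K" if "x \<in> carrier K" "y \<in> carrier K" for x y
      using img[OF that(1)] img[OF that(2)] by (auto simp: cl simp flip: mult)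
    show "\<one>\<^bsub>K\<^esub> \<otimes>\<^bsub>K\<^esub> x = x" if "x \<in> carrier K" for x
      using img[OF that] by (auto simp flip: mult one)
    show "x \<otimes>\<^bsub>K\<^esub> y \<otimes>\<^bsub>K\<^esub> z = x \<otimes>\<^bsub>K\<^esub> (y \<otimes>\<^bsub>K\<^esub> z)"
      if xyz: "x \<in> carrier K" "y \<in> carrier K" "z \<in> carrier K" for x y z
    proof -
      obtain a b c where "a \<in> carrier G" "b \<in> carrier G" "c \<in> carrier G"
        "x = \<psi> a" "y = \<psi> b" "z = \<psi> c"
        using img[OF xyz(1)] img[OF xyz(2)] img[OF xyz(3)] by blast
      then show ?thesis
        by (simp add: G.m_assoc flip: mult)
    qed
    show "\<exists>y\<in>carrier K. y \<otimes>\<^bsub>K\<^esub> x = \<one>\<^bsub>K\<^esub>" if x: "x \<in> carrier K" for x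
    proof -
      obtain a where "a \<in> carrier G" "x = \<psi> a"
        using img[OF x] by blast
      then show ?thesis
        by (intro bexI[of _ "\<psi> (inv\<^bsub>G\<^esub> a)"]) (simp_all add: cl one flip: mult)
    qed
  qed
  interpret \<psi>: group_hom G K \<psi>
    by unfold_locales (auto simp: hom_def cl mult)
  show K: "normed_group K rho"
  proof
    show "0 \<le> rho x" if "x \<in> carrier K" for x
      using img[OF that] norm G.norm_nonneg by auto
    show "rho (inv\<^bsub>K\<^esub> x) = rho x" if "x \<in> carrier K" for x
      using img[OF that] norm G.norm_inv by (auto simp flip: \<psi>.hom_inv)
    show "rho (x \<otimes>\<^bsub>K\<^esub> y) \<le> rho x + rho y" if "x \<in> carrier K" "y \<in> carrier K" for x y
      using img[OF that(1)] img[OF that(2)] norm G.norm_mult by (auto simp flip: mult)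
    show "rho x = 0 \<longleftrightarrow> x = \<one>\<^bsub>K\<^esub>" if "x \<in> carrier K" for x
      using img[OF that] norm G.norm_eq_zero_iff inj by (auto simp flip: one)
  qed
  interpret K: normed_group K rho by (rule K)
  have iso: "isometric_hom G lam K rho \<psi>"
    by (auto simp: isometric_hom_def norm \<psi>.homh)
  have "min_modulus K rho (\<psi> x) r \<le> min_modulus G lam x r" if x: "x \<in> carrier G" and r: "0 \<le> r" for x r
  proof -
    have "rho (\<psi> x \<otimes>\<^bsub>K\<^esub> k \<otimes>\<^bsub>K\<^esub> inv\<^bsub>K\<^esub> (\<psi> x)) \<le> min_modulus G lam x r \<and>
        rho (inv\<^bsub>K\<^esub> (\<psi> x) \<otimes>\<^bsub>K\<^esub> k \<otimes>\<^bsub>K\<^esub> \<psi> x) \<le> min_modulus G lam x r"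
      if k: "k \<in> carrier K" "rho k \<le> r" for k
    proof -
      obtain g where g: "g \<in> carrier G" "k = \<psi> g"
        using img k by blast
      then show ?thesis
        using G.min_modulus_ge(2,3)[OF x r, of g] norm[of g] k(2) x
          norm[of "x \<otimes>\<^bsub>G\<^esub> g \<otimes>\<^bsub>G\<^esub> inv\<^bsub>G\<^esub> x"] norm[of "inv\<^bsub>G\<^esub> x \<otimes>\<^bsub>G\<^esub> g \<otimes>\<^bsub>G\<^esub> x"] by simp
    qed
    then show ?thesis
      using x r G.min_modulus_ge(1)[OF x r] cl by (simp add: K.min_modulus_le_iff)
  qed
  with iso show "modulus_embedding G lam K rho \<psi>"
    by (simp add: modulus_embedding_def)
qed

lemma normed_group_transport_inj:
  fixes G :: "'a monoid" and \<psi> :: "'a \<Rightarrow> 'b"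
  assumes G: "normed_group G lam" and inj: "inj_on \<psi> (carrier G)"
  obtains K :: "'b monoid" and rho
  where "normed_group K rho" "modulus_embedding G lam K rho \<psi>" "carrier K = \<psi> ` carrier G"
proof
  let ?i = "inv_into (carrier G) \<psi>"
  let ?K = "\<lparr>carrier = \<psi> ` carrier G, mult = (\<lambda>a b. \<psi> (?i a \<otimes>\<^bsub>G\<^esub> ?i b)), one = \<psi> \<one>\<^bsub>G\<^esub>\<rparr>"
  have "bij_betw \<psi> (carrier G) (carrier ?K)"
    using inj by (simp add: bij_betw_def)
  moreover have "lam (?i (\<psi> x)) = lam x" if "x \<in> carrier G" for x
    using that inj by simp
  ultimately show "normed_group ?K (lam \<circ> ?i)" "modulus_embedding G lam ?K (lam \<circ> ?i) \<psi>"
    by (simp_all add: normed_group_transport[OF G, where \<psi> = \<psi>] inj)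
qed simp

section \<open>Approximation by a normed group\<close>

definition approximates ::
  "('a, 'm) monoid_scheme \<Rightarrow> ('a \<Rightarrow> real) \<Rightarrow> ('h, 'n) monoid_scheme \<Rightarrow> ('h \<Rightarrow> real) \<Rightarrow>
    'h set \<Rightarrow> real \<Rightarrow> bool" where
  "approximates K lam H rho F \<epsilon> \<longleftrightarrow>
    (\<exists>\<phi>. eps_homomorphism H rho K lam F \<epsilon> \<phi> \<and>
      (\<forall>f\<in>F. \<forall>r\<ge>0. min_modulus K lam (\<phi> f) r \<le> 2 * min_modulus H rho f r + \<epsilon> * r))"

text \<open>An approximation is composed with the embedding: isometry keeps both conditions of an
  approximate homomorphism, and the control of the moduli keeps the third.\<close>

lemma approximates_target:
  assumes K: "normed_group K lam" and K': "normed_group K' lam'"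
    and \<psi>: "modulus_embedding K lam K' lam' \<psi>" and approx: "approximates K lam H rho F \<epsilon>"
  shows "approximates K' lam' H rho F \<epsilon>"
proof -
  interpret K: normed_group K lam by (rule K)
  have iso: "isometric_hom K lam K' lam' \<psi>"
    using \<psi> by (simp add: modulus_embedding_def)
  note P = isometric_hom_props[OF K K' iso]
  obtain \<phi> where \<phi>: "eps_homomorphism H rho K lam F \<epsilon> \<phi>"
    and mod: "\<And>f r. f \<in> F \<Longrightarrow> 0 \<le> r \<Longrightarrow> min_modulus K lam (\<phi> f) r \<le> 2 * min_modulus H rho f r + \<epsilon> * r"
    using approx by (auto simp: approximates_def)
  have cl: "\<phi> g \<in> carrier K" if "g \<in> F" for g
    using \<phi> that by (simp add: eps_homomorphism_def)
  have "lam' (inv\<^bsub>K'\<^esub> (\<psi> x) \<otimes>\<^bsub>K'\<^esub> \<psi> y \<otimes>\<^bsub>K'\<^esub> \<psi> z) = lam (inv\<^bsub>K\<^esub> x \<otimes>\<^bsub>K\<^esub> y \<otimes>\<^bsub>K\<^esub> z)"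
    if "x \<in> carrier K" "y \<in> carrier K" "z \<in> carrier K" for x y z
    using that P(4)[of "inv\<^bsub>K\<^esub> x \<otimes>\<^bsub>K\<^esub> y \<otimes>\<^bsub>K\<^esub> z"] by (simp add: P(1-3))
  then have "eps_homomorphism H rho K' lam' F \<epsilon> (\<psi> \<circ> \<phi>)"
    using \<phi> cl unfolding eps_homomorphism_def by (simp add: P(1,4))
  moreover have "min_modulus K' lam' (\<psi> (\<phi> f)) r \<le> 2 * min_modulus H rho f r + \<epsilon> * r"
    if "f \<in> F" "0 \<le> r" for f r
    using \<psi> mod[OF that] cl[OF that(1)] that(2) unfolding modulus_embedding_def by (meson order_trans)
  ultimately show ?thesis
    unfolding approximates_def by (intro exI[of _ "\<psi> \<circ> \<phi>"]) simp
qed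

text \<open>The approximation is precomposed with the inverse of \<open>\<chi>\<close> on its image.
  The modulus on the right-hand side was computed in \<open>H'\<close> and can only increase in
  \<open>H\<close>.\<close>

lemma approximates_source:
  assumes H: "normed_group H rho" and H': "normed_group H' rho'"
    and \<chi>: "isometric_hom H' rho' H rho \<chi>" and F: "F \<subseteq> \<chi> ` carrier H'"
    and approx: "approximates K lam H' rho' (inv_into (carrier H') \<chi> ` F) \<epsilon>"
  shows "approximates K lam H rho F \<epsilon>"
proof -
  interpret H': normed_group H' rho' by (rule H')
  note P = isometric_hom_props[OF H' H \<chi>]
  define i where "i = inv_into (carrier H') \<chi>"
  obtain \<phi> where \<phi>: "eps_homomorphism H' rho' K lam (i ` F) \<epsilon> \<phi>"
    and mod: "\<And>f r. f \<in> F \<Longrightarrow> 0 \<le> r \<Longrightarrow>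
      min_modulus K lam (\<phi> (i f)) r \<le> 2 * min_modulus H' rho' (i f) r + \<epsilon> * r"
    using approx by (auto simp: approximates_def i_def)
  have i: "i f \<in> carrier H'" "\<chi> (i f) = f" if "f \<in> F" for f
    using F that by (auto simp: i_def inv_into_into f_inv_into_f)
  have mult: "i (g \<otimes>\<^bsub>H\<^esub> h) = i g \<otimes>\<^bsub>H'\<^esub> i h" if "g \<in> F" "h \<in> F" for g h
  proof -
    have "g \<otimes>\<^bsub>H\<^esub> h = \<chi> (i g \<otimes>\<^bsub>H'\<^esub> i h)"
      using that by (simp add: P i)
    then show ?thesis
      using P(5) i that by (simp add: i_def)
  qed
  have "rho' (i g) = rho g" if "g \<in> F" for g
    using P(4)[of "i g"] i[OF that] by simp
  then have "eps_homomorphism H rho K lam F \<epsilon> (\<phi> \<circ> i)"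
    using \<phi> unfolding eps_homomorphism_def by (auto simp flip: mult)
  moreover have "min_modulus K lam (\<phi> (i f)) r \<le> 2 * min_modulus H rho f r + \<epsilon> * r"
    if "f \<in> F" "0 \<le> r" for f r
    using mod[OF that] min_modulus_isometric_hom[OF H' H \<chi> i(1)[OF that(1)] that(2)] i[OF that(1)] by simp
  ultimately show ?thesis
    unfolding approximates_def by (intro exI[of _ "\<phi> \<circ> i"]) simp
qed

section \<open>Values of words\<close>

text \<open>The letter \<open>(True, a)\<close> stands for the generator \<open>a\<close> and \<open>(False, a)\<close> for its inverse.\<close>

fun word_val :: "('g, 'm) monoid_scheme \<Rightarrow> ('a \<Rightarrow> 'g) \<Rightarrow> (bool \<times> 'a) list \<Rightarrow> 'g" where
  "word_val G \<sigma> [] = \<one>\<^bsub>G\<^esub>"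
| "word_val G \<sigma> (l # w) =
    (if fst l then \<sigma> (snd l) else inv\<^bsub>G\<^esub> (\<sigma> (snd l))) \<otimes>\<^bsub>G\<^esub> word_val G \<sigma> w"

definition word_inv :: "(bool \<times> 'a) list \<Rightarrow> (bool \<times> 'a) list" where
  "word_inv w = rev (map (\<lambda>l. (\<not> fst l, snd l)) w)"

definition words :: "'a set \<Rightarrow> (bool \<times> 'a) list set" where
  "words A = lists (UNIV \<times> A)"

lemma words_simps [simp]:
  "[] \<in> words A"
  "l # w \<in> words A \<longleftrightarrow> snd l \<in> A \<and> w \<in> words A"
  "v @ w \<in> words A \<longleftrightarrow> v \<in> words A \<and> w \<in> words A"
  "word_inv w \<in> words A \<longleftrightarrow> w \<in> words A"
  by (auto simp: words_def word_inv_def in_lists_conv_set mem_Times_iff)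

lemma length_word_inv [simp]: "length (word_inv w) = length w"
  by (simp add: word_inv_def)

lemma countable_words: "countable A \<Longrightarrow> countable (words A)"
  by (simp add: words_def)

lemma finite_words_length_le: "finite A \<Longrightarrow> finite {w \<in> words A. length w \<le> n}"
  unfolding words_def lists_eq_set by (simp add: finite_lists_length_le)

context group
begin

lemma word_val_closed [simp]: "\<sigma> \<in> A \<rightarrow> carrier G \<Longrightarrow> w \<in> words A \<Longrightarrow> word_val G \<sigma> w \<in> carrier G"
  by (induction w) (auto simp: Pi_iff)

lemma word_val_append:
  "\<sigma> \<in> A \<rightarrow> carrier G \<Longrightarrow> v \<in> words A \<Longrightarrow> w \<in> words A \<Longrightarrow>
    word_val G \<sigma> (v @ w) = word_val G \<sigma> v \<otimes> word_val G \<sigma> w"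
proof (induction v)
  case (Cons l v)
  then have "\<sigma> (snd l) \<in> carrier G" "word_val G \<sigma> v \<in> carrier G" "word_val G \<sigma> w \<in> carrier G"
    by (auto intro: word_val_closed)
  then show ?case
    using Cons by (simp add: m_assoc)
qed simp

lemma word_val_inv:
  "\<sigma> \<in> A \<rightarrow> carrier G \<Longrightarrow> w \<in> words A \<Longrightarrow> word_val G \<sigma> (word_inv w) = inv (word_val G \<sigma> w)"
proof (induction w)
  case Nil
  then show ?case by (simp add: word_inv_def)
next
  case (Cons l w)
  have s: "\<sigma> (snd l) \<in> carrier G" "word_val G \<sigma> w \<in> carrier G"
    using Cons.prems by (auto intro: word_val_closed)
  have "word_inv (l # w) = word_inv w @ [(\<not> fst l, snd l)]"
    by (simp add: word_inv_def)
  then show ?case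
    using Cons s by (simp add: word_val_append[where A = A] inv_mult_group)
qed

lemma subgroup_word_val:
  assumes "\<sigma> \<in> A \<rightarrow> carrier G"
  shows "subgroup (word_val G \<sigma> ` words A) G"
proof (rule subgroupI)
  show "word_val G \<sigma> ` words A \<subseteq> carrier G" "word_val G \<sigma> ` words A \<noteq> {}"
    using assms by (auto intro: words_simps(1))
  show "inv x \<in> word_val G \<sigma> ` words A" if "x \<in> word_val G \<sigma> ` words A" for x
    using that by (auto simp flip: word_val_inv[OF assms])
  show "x \<otimes> y \<in> word_val G \<sigma> ` words A"
    if "x \<in> word_val G \<sigma> ` words A" "y \<in> word_val G \<sigma> ` words A" for x y
    using that by (auto simp flip: word_val_append[OF assms])
qed

end

section \<open>Reduction to groups with carrier in the natural numbers\<close>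

text \<open>The subgroup generated by \<open>F\<close> consists of values of words over
  \<open>F\<close>, hence is countable and has a copy on the natural numbers. The map
  \<open>\<chi>\<close> decodes this copy.\<close>

lemma isometric_hom_nat_covering:
  fixes H :: "'h monoid"
  assumes H: "normed_topological_group H rho" and F: "countable F" "F \<subseteq> carrier H"
  obtains H' :: "nat monoid" and rho' \<chi>
  where "normed_topological_group H' rho'" "isometric_hom H' rho' H rho \<chi>" "F \<subseteq> \<chi> ` carrier H'"
proof -
  interpret H: normed_topological_group H rho by (rule H)
  define S where "S = word_val H (\<lambda>f. f) ` words F"
  have S: "subgroup S H"
    unfolding S_def using F(2) by (intro H.subgroup_word_val) auto
  interpret S: subgroup S H by (rule S)
  have cS: "countable S"
    unfolding S_def using F(1) by (simp add: countable_words)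
  have FS: "F \<subseteq> S"
  proof
    fix f assume f: "f \<in> F"
    then have "f = word_val H (\<lambda>f. f) [(True, f)]"
      using F(2) by auto
    then show "f \<in> S"
      unfolding S_def using f by (intro image_eqI[of _ _ "[(True, f)]"]) auto
  qed
  define H0 where "H0 = H\<lparr>carrier := S\<rparr>"
  interpret H0: group H0
    unfolding H0_def using S by (rule H.subgroup_imp_group)
  have inv0: "inv\<^bsub>H0\<^esub> x = inv\<^bsub>H\<^esub> x" if "x \<in> S" for x
    using H.m_inv_consistent[OF S that] by (simp add: H0_def)
  have H0: "normed_group H0 rho"
    by unfold_locales
      (auto simp: H0_def H.norm_nonneg H.norm_inv H.norm_mult H.norm_eq_zero_iff
        inv0[unfolded H0_def])
  interpret H0: normed_group H0 rho by (rule H0)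
  have carrier0: "carrier H0 = S"
    by (simp add: H0_def)
  obtain H' :: "nat monoid" and rho'
    where H': "normed_group H' rho'" and emb: "modulus_embedding H0 rho H' rho' (to_nat_on S)"
      and carrier': "carrier H' = to_nat_on S ` S"
    using normed_group_transport_inj[OF H0, of "to_nat_on S"] cS carrier0
    by (metis inj_on_to_nat_on)
  interpret H': normed_group H' rho' by (rule H')
  have iso: "isometric_hom H0 rho H' rho' (to_nat_on S)"
    using emb by (simp add: modulus_embedding_def)
  note P = isometric_hom_props[OF H0 H' iso, unfolded carrier0]
  define \<chi> where "\<chi> = from_nat_into S"
  have \<chi>: "\<chi> (to_nat_on S x) = x" if "x \<in> S" for x
    using cS that by (simp add: \<chi>_def)
  have "\<chi> (to_nat_on S x \<otimes>\<^bsub>H'\<^esub> to_nat_on S y) = x \<otimes>\<^bsub>H\<^esub> y" if "x \<in> S" "y \<in> S" for x y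
    using \<chi>[of "x \<otimes>\<^bsub>H\<^esub> y"] P(2)[OF that] that by (simp add: H0_def)
  then have iso': "isometric_hom H' rho' H rho \<chi>"
    unfolding isometric_hom_def hom_def carrier' by (auto simp: \<chi> P(4) S.mem_carrier)
  note Q = isometric_hom_props[OF H' H.normed_group_axioms iso']
  \<comment> \<open>Continuity restricts to subgroups: the \<open>\<delta>\<close> for
    \<open>\<chi> x\<close> in \<open>H\<close> also serves for \<open>x\<close>.\<close>
  have "normed_topological_group H' rho'"
  proof
    fix x and \<epsilon> :: real assume x: "x \<in> carrier H'" and "0 < \<epsilon>"
    then obtain \<delta> where \<delta>: "\<delta> > 0"
      "\<And>y. y \<in> carrier H \<Longrightarrow> rho y < \<delta> \<Longrightarrow> rho (inv\<^bsub>H\<^esub> \<chi> x \<otimes>\<^bsub>H\<^esub> y \<otimes>\<^bsub>H\<^esub> \<chi> x) < \<epsilon>"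
      using H.norm_continuous Q(1) by metis
    have "rho' (inv\<^bsub>H'\<^esub> x \<otimes>\<^bsub>H'\<^esub> y \<otimes>\<^bsub>H'\<^esub> x) < \<epsilon>" if "y \<in> carrier H'" "rho' y < \<delta>" for y
      using \<delta>(2)[of "\<chi> y"] that x Q(4)[of "inv\<^bsub>H'\<^esub> x \<otimes>\<^bsub>H'\<^esub> y \<otimes>\<^bsub>H'\<^esub> x"] Q(4)[of y]
      by (simp add: Q(1-3))
    with \<delta>(1) show "\<exists>\<delta>>0. \<forall>y\<in>carrier H'. rho' y < \<delta> \<longrightarrow> rho' (inv\<^bsub>H'\<^esub> x \<otimes>\<^bsub>H'\<^esub> y \<otimes>\<^bsub>H'\<^esub> x) < \<epsilon>"
      by blast
  qed
  moreover have "F \<subseteq> \<chi> ` carrier H'"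
    using FS \<chi> by (force simp: carrier' image_image)
  ultimately show thesis
    using iso' that by blast
qed

section \<open>Finite products with the maximum norm\<close>

text \<open>The inserted 0 gives \<open>Max\<close> a value for the empty index set; otherwise it
  changes nothing, as norms are nonnegative.\<close>

definition product_norm :: "'i set \<Rightarrow> ('i \<Rightarrow> 'a \<Rightarrow> real) \<Rightarrow> ('i \<Rightarrow> 'a) \<Rightarrow> real" where
  "product_norm I lam x = Max (insert 0 ((\<lambda>i. lam i (x i)) ` I))"

lemma product_norm_le_iff:
  "finite I \<Longrightarrow> product_norm I lam x \<le> B \<longleftrightarrow> 0 \<le> B \<and> (\<forall>i\<in>I. lam i (x i) \<le> B)"
  by (simp add: product_norm_def)

lemma product_norm_ge:
  assumes "finite I"
  shows "0 \<le> product_norm I lam x" and "i \<in> I \<Longrightarrow> lam i (x i) \<le> product_norm I lam x"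
  using product_norm_le_iff[OF assms, of lam x "product_norm I lam x"] by auto

lemma normed_group_product:
  assumes fin: "finite I" and K: "\<And>i. i \<in> I \<Longrightarrow> normed_group (K i) (lam i)"
  shows "normed_group (product_group I K) (product_norm I lam)"
proof -
  have grp: "group (K i)" if "i \<in> I" for i
    using K[OF that] by (simp add: normed_group_def)
  interpret group "product_group I K"
    by (simp add: grp)
  note ge = product_norm_ge[OF fin, where lam = lam]
  show ?thesis
  proof
    show "0 \<le> product_norm I lam x" for x
      by (rule ge)
    show "product_norm I lam (inv\<^bsub>product_group I K\<^esub> x) = product_norm I lam x"
      if "x \<in> carrier (product_group I K)" for x
    proof -
      have "lam i (inv\<^bsub>K i\<^esub> x i) = lam i (x i)" if "i \<in> I" for i
        using \<open>x \<in> carrier _\<close> that by (intro normed_group.norm_inv[OF K]) auto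
      then show ?thesis
        using that by (simp add: product_norm_def grp cong: image_cong)
    qed
    show "product_norm I lam (x \<otimes>\<^bsub>product_group I K\<^esub> y) \<le> product_norm I lam x + product_norm I lam y"
      if "x \<in> carrier (product_group I K)" "y \<in> carrier (product_group I K)" for x y
    proof -
      have "lam i (x i \<otimes>\<^bsub>K i\<^esub> y i) \<le> product_norm I lam x + product_norm I lam y" if "i \<in> I" for i
      proof -
        have "x i \<in> carrier (K i)" "y i \<in> carrier (K i)"
          using \<open>x \<in> carrier _\<close> \<open>y \<in> carrier _\<close> that by auto
        then show ?thesis
          using normed_group.norm_mult[OF K[OF that]] ge(2)[OF that, of x] ge(2)[OF that, of y]
          by (meson add_mono order_trans)
      qed
      then show ?thesis
        using ge(1)[of x] ge(1)[of y] by (simp add: product_norm_le_iff fin)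
    qed
    show "product_norm I lam x = 0 \<longleftrightarrow> x = \<one>\<^bsub>product_group I K\<^esub>"
      if "x \<in> carrier (product_group I K)" for x
    proof -
      have xi: "x i \<in> carrier (K i)" if "i \<in> I" for i
        using \<open>x \<in> carrier _\<close> that by auto
      have "product_norm I lam x = 0 \<longleftrightarrow> product_norm I lam x \<le> 0"
        using ge(1)[of x] by auto
      also have "\<dots> \<longleftrightarrow> (\<forall>i\<in>I. lam i (x i) \<le> 0)"
        by (simp add: product_norm_le_iff fin)
      also have "\<dots> \<longleftrightarrow> (\<forall>i\<in>I. x i = \<one>\<^bsub>K i\<^esub>)"
        using K xi by (metis normed_group.norm_eq_zero_iff normed_group.norm_nonneg order_antisym order_refl)
      also have "\<dots> \<longleftrightarrow> x = \<one>\<^bsub>product_group I K\<^esub>"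
        using that by (auto simp: PiE_def extensional_def fun_eq_iff)
      finally show ?thesis .
    qed
  qed
qed

text \<open>Conjugation by an element supported in coordinate \<open>j\<close> affects only that
  coordinate, where the modulus of \<open>x\<close> is the bound.\<close>

lemma modulus_embedding_product:
  assumes fin: "finite I" and K: "\<And>i. i \<in> I \<Longrightarrow> normed_group (K i) (lam i)" and j: "j \<in> I"
  shows "modulus_embedding (K j) (lam j) (product_group I K) (product_norm I lam)
    (\<lambda>x. \<lambda>i\<in>I. if i = j then x else \<one>\<^bsub>K i\<^esub>)" (is "modulus_embedding _ _ ?P ?norm ?\<psi>")
proof -
  interpret P: normed_group ?P ?norm
    by (rule normed_group_product[OF fin K])
  interpret Kj: normed_group "K j" "lam j"
    by (rule K[OF j])
  have grp: "group (K i)" if "i \<in> I" for i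
    using K[OF that] by (simp add: normed_group_def)
  have one: "\<one>\<^bsub>K i\<^esub> \<in> carrier (K i)" if "i \<in> I" for i
    using grp[OF that] by (simp add: group.is_monoid)
  have cl: "?\<psi> x \<in> carrier ?P" if "x \<in> carrier (K j)" for x
    using that one by (auto simp: PiE_def)
  have norm: "?norm (?\<psi> x) = lam j x" if x: "x \<in> carrier (K j)" for x
  proof (rule antisym)
    have "lam i \<one>\<^bsub>K i\<^esub> = 0" if "i \<in> I" for i
      using K[OF that] one[OF that] by (simp add: normed_group.norm_eq_zero_iff)
    then show "?norm (?\<psi> x) \<le> lam j x"
      using x Kj.norm_nonneg by (simp add: product_norm_le_iff fin)
    show "lam j x \<le> ?norm (?\<psi> x)"
      using product_norm_ge(2)[OF fin j, where lam = lam and x = "?\<psi> x"] j by simp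
  qed
  have mult: "?\<psi> (x \<otimes>\<^bsub>K j\<^esub> y) = ?\<psi> x \<otimes>\<^bsub>?P\<^esub> ?\<psi> y" for x y
    using grp one by (auto simp: fun_eq_iff group.is_monoid)
  have "min_modulus ?P ?norm (?\<psi> x) r \<le> min_modulus (K j) (lam j) x r"
    if x: "x \<in> carrier (K j)" and r: "0 \<le> r" for x r
  proof -
    let ?m = "min_modulus (K j) (lam j) x r"
    note m = Kj.min_modulus_ge[OF x r]
    have "?norm (?\<psi> x \<otimes>\<^bsub>?P\<^esub> g \<otimes>\<^bsub>?P\<^esub> inv\<^bsub>?P\<^esub> (?\<psi> x)) \<le> ?m \<and>
        ?norm (inv\<^bsub>?P\<^esub> (?\<psi> x) \<otimes>\<^bsub>?P\<^esub> g \<otimes>\<^bsub>?P\<^esub> ?\<psi> x) \<le> ?m"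
      if g: "g \<in> carrier ?P" "?norm g \<le> r" for g
    proof -
      have gi: "g i \<in> carrier (K i)" "lam i (g i) \<le> r" if "i \<in> I" for i
        using g that by (auto simp: product_norm_le_iff fin)
      have inv: "inv\<^bsub>?P\<^esub> (?\<psi> x) = (\<lambda>i\<in>I. inv\<^bsub>K i\<^esub> (?\<psi> x i))"
        using cl[OF x] by (intro inv_product_group grp) simp
      have "lam i (?\<psi> x i \<otimes>\<^bsub>K i\<^esub> g i \<otimes>\<^bsub>K i\<^esub> inv\<^bsub>K i\<^esub> (?\<psi> x i)) \<le> ?m \<and>
          lam i (inv\<^bsub>K i\<^esub> (?\<psi> x i) \<otimes>\<^bsub>K i\<^esub> g i \<otimes>\<^bsub>K i\<^esub> ?\<psi> x i) \<le> ?m" if i: "i \<in> I" for i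
      proof (cases "i = j")
        case True
        then show ?thesis
          using m(2,3)[of "g j"] gi[OF j] j by simp
      next
        \<comment> \<open>An untouched coordinate has norm at most \<open>r\<close>. The modulus
          dominates it because its definition takes a maximum with \<open>r\<close>.\<close>
        case False
        interpret Ki: group "K i" by (rule grp[OF i])
        show ?thesis
          using False i gi[OF i] m(1) by simp
      qed
      moreover have "0 \<le> ?m"
        using m(1) r by simp
      ultimately show ?thesis
        by (simp add: product_norm_le_iff fin inv)
    qed
    then show ?thesis
      using m(1) by (subst P.min_modulus_le_iff[OF cl[OF x] r]) blast
  qed
  then show ?thesis
    unfolding modulus_embedding_def isometric_hom_def hom_def using cl norm mult by blast
qed

section \<open>A universal sequence of finite groups with rational norms\<close>

text \<open>
  A code consists of a multiplication table, the numerators of the norm values, the unit and the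
  common denominator; not every code describes a normed group.
\<close>

type_synonym code = "nat list list \<times> nat list \<times> nat \<times> nat"

fun code_group :: "code \<Rightarrow> nat monoid" where
  "code_group (t, v, e, N) = \<lparr>carrier = {0..<length t}, mult = (\<lambda>a b. t ! a ! b), one = e\<rparr>"

fun code_norm :: "code \<Rightarrow> nat \<Rightarrow> real" where
  "code_norm (t, v, e, N) a = real (v ! a) / real N"

text \<open>Numbering the finite carrier by an initial segment of the natural numbers turns the
  multiplication and the norm into finite tables.\<close>

lemma rational_norm_coded:
  assumes K: "normed_group K lam" and fin: "finite (carrier K)"
    and rat: "\<And>x. x \<in> carrier K \<Longrightarrow> lam x = real (\<nu> x) / real N"
  obtains c \<psi> where "normed_group (code_group c) (code_norm c)"
    "modulus_embedding K lam (code_group c) (code_norm c) \<psi>"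
proof -
  interpret K: normed_group K lam by (rule K)
  obtain \<psi> where \<psi>: "bij_betw \<psi> (carrier K) {0..<card (carrier K)}"
    using ex_bij_betw_finite_nat[OF fin] by blast
  define n where "n = card (carrier K)"
  define i where "i = inv_into (carrier K) \<psi>"
  have i: "i (\<psi> x) = x" "\<psi> x < n" if "x \<in> carrier K" for x
    using \<psi> that bij_betw_apply[OF \<psi> that] by (auto simp: i_def n_def bij_betw_def)
  define c :: code where
    "c = (map (\<lambda>a. map (\<lambda>b. \<psi> (i a \<otimes>\<^bsub>K\<^esub> i b)) [0..<n]) [0..<n], map (\<lambda>a. \<nu> (i a)) [0..<n], \<psi> \<one>\<^bsub>K\<^esub>, N)"
  have bij: "bij_betw \<psi> (carrier K) (carrier (code_group c))"
    using \<psi> by (simp add: c_def n_def)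
  have mult: "\<psi> (x \<otimes>\<^bsub>K\<^esub> y) = \<psi> x \<otimes>\<^bsub>code_group c\<^esub> \<psi> y" if "x \<in> carrier K" "y \<in> carrier K" for x y
    using that by (simp add: c_def i)
  have one: "\<psi> \<one>\<^bsub>K\<^esub> = \<one>\<^bsub>code_group c\<^esub>"
    by (simp add: c_def)
  have norm: "code_norm c (\<psi> x) = lam x" if "x \<in> carrier K" for x
    using that by (simp add: c_def i rat)
  show thesis
    using normed_group_transport[OF K bij mult one norm] that by blast
qed

text \<open>The group with index \<open>i\<close> is a copy of the product of all valid code groups
  whose code number is at most \<open>i\<close>. A valid code \<open>c\<close> is thus a factor from
  the index \<open>to_nat c\<close> on.\<close>

lemma universal_sequence:
  obtains G :: "nat \<Rightarrow> nat monoid" and lam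
  where "finite_normed_groups G lam"
    and "\<And>c. normed_group (code_group c) (code_norm c) \<Longrightarrow>
      \<exists>i\<^sub>0. \<forall>i\<ge>i\<^sub>0. \<exists>\<psi>. modulus_embedding (code_group c) (code_norm c) (G i) (lam i) \<psi>"
proof -
  define valid where "valid c \<longleftrightarrow> normed_group (code_group c) (code_norm c)" for c
  have "\<exists>(K :: nat monoid) lam. normed_group K lam \<and> finite (carrier K) \<and>
      (\<forall>c. valid c \<and> to_nat c \<le> i \<longrightarrow> (\<exists>\<psi>. modulus_embedding (code_group c) (code_norm c) K lam \<psi>))"
    for i :: nat
  proof -
    define I where "I = {c. valid c \<and> to_nat c \<le> i}"
    have "I \<subseteq> from_nat ` {..i}"
      by (force simp: I_def image_iff intro: from_nat_to_nat[symmetric])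
    then have fin: "finite I"
      by (rule finite_subset) simp
    have I: "normed_group (code_group c) (code_norm c)" if "c \<in> I" for c
      using that by (simp add: I_def valid_def)
    let ?P = "product_group I code_group" and ?n = "product_norm I code_norm"
    have P: "normed_group ?P ?n"
      by (rule normed_group_product[OF fin I])
    have finP: "finite (carrier ?P)"
      using fin by (auto intro!: finite_PiE simp: prod_cases4)
    \<comment> \<open>The product consists of functions on codes; an injection of its finite carrier
      moves it to the type \<open>nat\<close>.\<close>
    then obtain h :: "_ \<Rightarrow> nat" where "inj_on h (carrier ?P)"
      using finite_imp_inj_to_nat_seg by metis
    then obtain K :: "nat monoid" and lam where K: "normed_group K lam"
      "modulus_embedding ?P ?n K lam h" "carrier K = h ` carrier ?P"
      using normed_group_transport_inj[OF P] by metis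
    have "\<exists>\<psi>. modulus_embedding (code_group c) (code_norm c) K lam \<psi>" if "valid c" "to_nat c \<le> i" for c
      using modulus_embedding_compose[OF modulus_embedding_product[OF fin I] K(2)] that
      unfolding I_def by blast
    then show ?thesis
      using K(1,3) finP by (intro exI[of _ K] exI[of _ lam]) (simp del: split_paired_All)
  qed
  then obtain G :: "nat \<Rightarrow> nat monoid" and lam where G: "\<And>i. normed_group (G i) (lam i) \<and>
      finite (carrier (G i)) \<and> (\<forall>c. valid c \<and> to_nat c \<le> i \<longrightarrow>
        (\<exists>\<psi>. modulus_embedding (code_group c) (code_norm c) (G i) (lam i) \<psi>))"
    by metis
  show thesis
  proof
    show "finite_normed_groups G lam"
      using G by (simp add: finite_normed_groups_def)
    show "\<exists>i\<^sub>0. \<forall>i\<ge>i\<^sub>0. \<exists>\<psi>. modulus_embedding (code_group c) (code_norm c) (G i) (lam i) \<psi>"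
      if "normed_group (code_group c) (code_norm c)" for c
      using G that unfolding valid_def by blast
  qed
qed

section \<open>Finite approximation of a normed group\<close>

text \<open>In a finite set the complements of the domain and of the image have equal size, so any
  bijection between them completes \<open>g\<close>.\<close>

lemma partial_injection_extends:
  assumes X: "finite X" and D: "D \<subseteq> X" and inj: "inj_on g D" and img: "g ` D \<subseteq> X"
  obtains p where "p \<in> Bij X" "\<And>x. x \<in> D \<Longrightarrow> p x = g x"
proof -
  have "card (X - D) = card (X - g ` D)"
    using X D img inj by (simp add: card_Diff_subset finite_subset card_image)
  then obtain b where b: "bij_betw b (X - D) (X - g ` D)"
    using X by (metis finite_Diff finite_same_card_bij)
  let ?p = "\<lambda>x\<in>X. if x \<in> D then g x else b x"
  have "bij_betw ?p D (g ` D)"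
    using inj D by (subst bij_betw_cong[where g = g]) (auto simp: bij_betw_def)
  moreover have "bij_betw ?p (X - D) (X - g ` D)"
    using b by (subst bij_betw_cong[where g = b]) auto
  ultimately have "bij_betw ?p (D \<union> (X - D)) (g ` D \<union> (X - g ` D))"
    by (rule bij_betw_combine) auto
  then have "?p \<in> Bij X"
    using D img by (simp add: Bij_def Un_absorb1 del: restrict_apply)
  then show thesis
    by (rule that) (use D in auto)
qed

text \<open>
  Left multiplication by \<open>f\<close> is a partial injection on the ball of radius \<open>L\<close> in the Cayley graph;
  any extension to a permutation still lets words of length at most \<open>L\<close> act correctly on the unit.
\<close>

lemma finite_permutation_model:
  fixes H :: "'h monoid"
  assumes H: "group H" and F: "finite F" "F \<subseteq> carrier H"
  obtains K :: "('h \<Rightarrow> 'h) monoid" and \<sigma>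
  where "group K" "finite (carrier K)" "\<sigma> \<in> F \<rightarrow> carrier K"
    and "\<And>w. w \<in> words F \<Longrightarrow> length w \<le> L \<Longrightarrow> word_val K \<sigma> w = \<one>\<^bsub>K\<^esub> \<Longrightarrow>
      word_val H (\<lambda>f. f) w = \<one>\<^bsub>H\<^esub>"
proof -
  interpret H: group H by (rule H)
  let ?h = "word_val H (\<lambda>f. f)"
  have hF: "(\<lambda>f. f) \<in> F \<rightarrow> carrier H"
    using F(2) by auto
  define X where "X = ?h ` {w \<in> words F. length w \<le> L}"
  have finX: "finite X"
    unfolding X_def using finite_words_length_le[OF F(1)] by blast
  have XH: "X \<subseteq> carrier H"
    unfolding X_def using H.word_val_closed[OF hF] by auto
  have hX: "?h w \<in> X" if "w \<in> words F" "length w \<le> L" for w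
    unfolding X_def using that by blast
  \<comment> \<open>Multiplication by \<open>f\<close> is prescribed only at points that it keeps
    inside \<open>X\<close>; elsewhere the permutation is arbitrary.\<close>
  have "\<exists>p. p \<in> Bij X \<and> (\<forall>x\<in>X. f \<otimes>\<^bsub>H\<^esub> x \<in> X \<longrightarrow> p x = f \<otimes>\<^bsub>H\<^esub> x)" if f: "f \<in> F" for f
  proof -
    have "inj_on (\<lambda>x. f \<otimes>\<^bsub>H\<^esub> x) {x \<in> X. f \<otimes>\<^bsub>H\<^esub> x \<in> X}"
      using XH F(2) f by (auto simp: inj_on_def subset_iff)
    then obtain p where "p \<in> Bij X" "\<And>x. x \<in> {x \<in> X. f \<otimes>\<^bsub>H\<^esub> x \<in> X} \<Longrightarrow> p x = f \<otimes>\<^bsub>H\<^esub> x"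
      by (rule partial_injection_extends[OF finX, rotated]) auto
    then show ?thesis by blast
  qed
  then obtain \<sigma> where \<sigma>: "\<And>f. f \<in> F \<Longrightarrow> \<sigma> f \<in> Bij X"
    and \<sigma>_app: "\<And>f x. f \<in> F \<Longrightarrow> x \<in> X \<Longrightarrow> f \<otimes>\<^bsub>H\<^esub> x \<in> X \<Longrightarrow> \<sigma> f x = f \<otimes>\<^bsub>H\<^esub> x"
    by metis
  let ?K = "BijGroup X"
  interpret K: group ?K by (rule group_BijGroup)
  have carrier: "carrier ?K = Bij X" and one: "\<one>\<^bsub>?K\<^esub> = (\<lambda>x\<in>X. x)"
    and mult: "p \<in> Bij X \<Longrightarrow> q \<in> Bij X \<Longrightarrow> x \<in> X \<Longrightarrow> (p \<otimes>\<^bsub>?K\<^esub> q) x = p (q x)" for p q x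
    by (simp_all add: BijGroup_def compose_def)
  have \<sigma>F: "\<sigma> \<in> F \<rightarrow> carrier ?K"
    using \<sigma> carrier by auto
  have 1: "\<one>\<^bsub>H\<^esub> \<in> X"
    using hX[of "[]"] by simp
  \<comment> \<open>All suffixes of \<open>w\<close> also have length at most \<open>L\<close>, so
    the successive images of the unit stay in \<open>X\<close>, where each letter acts as
    multiplication in \<open>H\<close>.\<close>
  have act: "word_val ?K \<sigma> w \<one>\<^bsub>H\<^esub> = ?h w" if "w \<in> words F" "length w \<le> L" for w
    using that
  proof (induction w)
    case Nil
    then show ?case using 1 by (simp add: one)
  next
    case (Cons l w)
    obtain b f where l: "l = (b, f)" by force
    have f: "f \<in> F" "f \<in> carrier H" and w: "w \<in> words F"
      using Cons.prems F(2) l by auto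
    have IH: "word_val ?K \<sigma> w \<one>\<^bsub>H\<^esub> = ?h w" and y: "?h w \<in> X" and z: "?h (l # w) \<in> X"
      using Cons hX[of w] hX[of "l # w"] by auto
    have wK: "word_val ?K \<sigma> w \<in> Bij X"
      using K.word_val_closed[OF \<sigma>F w] carrier by simp
    have hw: "?h w \<in> carrier H"
      using XH y by blast
    show ?case
    proof (cases b)
      case True
      then show ?thesis
        using \<sigma>_app[OF f(1) y] z IH mult[OF \<sigma>[OF f(1)] wK 1] l by simp
    next
      case False
      \<comment> \<open>For an inverse letter, both \<open>?z\<close> and \<open>f\<close> times
        \<open>?z\<close> lie in \<open>X\<close>. Hence \<open>\<sigma> f\<close> takes
        \<open>?z\<close> to the current point, and its inverse goes back.\<close>
      let ?z = "inv\<^bsub>H\<^esub> f \<otimes>\<^bsub>H\<^esub> ?h w"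
      have z': "?z \<in> X"
        using z False l by simp
      have fz: "f \<otimes>\<^bsub>H\<^esub> ?z = ?h w"
        using f(2) hw by (simp flip: H.m_assoc)
      have inv: "inv\<^bsub>?K\<^esub> (\<sigma> f) = (\<lambda>x\<in>X. inv_into X (\<sigma> f) x)"
        using \<sigma>[OF f(1)] by (rule inv_BijGroup)
      have "\<sigma> f ?z = ?h w"
        using \<sigma>_app[OF f(1) z'] y by (simp add: fz)
      moreover have "inj_on (\<sigma> f) X"
        using \<sigma>[OF f(1)] by (simp add: Bij_def bij_betw_def)
      ultimately have "(inv\<^bsub>?K\<^esub> (\<sigma> f)) (?h w) = ?z"
        unfolding inv using y z' by (simp add: inv_into_f_eq)
      moreover have "inv\<^bsub>?K\<^esub> (\<sigma> f) \<in> Bij X"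
        using K.inv_closed \<sigma>[OF f(1)] carrier by blast
      ultimately show ?thesis
        using mult[OF _ wK 1] False l IH by simp
    qed
  qed
  show thesis
  proof
    show "group ?K" by (rule group_BijGroup)
    have "carrier ?K \<subseteq> X \<rightarrow>\<^sub>E X"
      using Bij_imp_funcset Bij_imp_extensional by (force simp: carrier PiE_def)
    then show "finite (carrier ?K)"
      using finX by (meson finite_PiE finite_subset)
    show "\<sigma> \<in> F \<rightarrow> carrier ?K" by (rule \<sigma>F)
    show "?h w = \<one>\<^bsub>H\<^esub>" if "w \<in> words F" "length w \<le> L" "word_val ?K \<sigma> w = \<one>\<^bsub>?K\<^esub>" for w
      using act[OF that(1,2)] that(3) 1 by (simp add: one)
  qed
qed

text \<open>
  The norm of \<open>k \<noteq> 1\<close> is \<open>1/N\<close> times the least cost of a word representing \<open>k\<close>, where a word \<open>w\<close>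
  costs \<open>M\<close> plus its length plus the rounded value of \<open>N\<close> times its norm in \<open>H\<close>. The length
  penalty makes long relators of \<open>K\<close> harmless, and the offset \<open>M\<close> makes the additional cost of a
  conjugation by a letter relatively small. Costs are capped at \<open>B\<close>, which also covers elements that
  no word represents. The factor 2 in the inequality of moduli comes from the penalty: it may use up
  all of \<open>r\<close> in addition to the modulus of \<open>f\<close>.
\<close>

lemma finite_rational_approximation:
  fixes H :: "'h monoid"
  assumes H: "normed_group H rho" and F: "finite F" "F \<subseteq> carrier H" and \<epsilon>: "0 < (\<epsilon>::real)"
  obtains K :: "('h \<Rightarrow> 'h) monoid" and lam \<nu> N
  where "normed_group K lam" "finite (carrier K)" "\<And>k. lam k = real (\<nu> k) / real N"
    "approximates K lam H rho F \<epsilon>"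
proof -
  interpret H: normed_group H rho by (rule H)
  \<comment> \<open>Conjugation by a letter costs at most 3 beyond the budget: two letters and one
    unit of rounding. The choice of \<open>M\<close> makes this a fraction at most
    \<open>\<epsilon>\<close> of the offset.\<close>
  define M where "M = nat \<lceil>3 / \<epsilon>\<rceil> + 1"
  \<comment> \<open>After division by \<open>N\<close>, the penalty \<open>M + 3\<close> of a
    relator of length three falls below \<open>\<epsilon>\<close>.\<close>
  define N where "N = nat \<lceil>(M + 3) / \<epsilon>\<rceil> + 1"
  \<comment> \<open>The cap must not push the norm of a generator below its norm in
    \<open>H\<close>, so it dominates all \<open>N * rho f\<close>; the summand 1 keeps it
    positive.\<close>
  define B where "B = 1 + (\<Sum>f\<in>F. nat \<lceil>N * rho f\<rceil>)"
  have M: "3 \<le> \<epsilon> * M"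
  proof -
    have "3 / \<epsilon> \<le> M" unfolding M_def by linarith
    then show ?thesis using \<epsilon> by (simp add: field_simps)
  qed
  have N: "real (M + 3) < \<epsilon> * N" "0 < N"
  proof -
    have "real (M + 3) / \<epsilon> < N" unfolding N_def by linarith
    then show "real (M + 3) < \<epsilon> * N" using \<epsilon> by (simp add: field_simps)
  qed (simp add: N_def)
  have B: "N * rho f \<le> B" if "f \<in> F" for f
  proof -
    have "nat \<lceil>N * rho f\<rceil> \<le> (\<Sum>f\<in>F. nat \<lceil>N * rho f\<rceil>)"
      using that F(1) by (intro member_le_sum) auto
    then show ?thesis unfolding B_def by linarith
  qed
  \<comment> \<open>The length bound \<open>B + 1\<close> leaves room for one letter appended to a
    word of length at most \<open>B\<close>.\<close>
  obtain K :: "('h \<Rightarrow> 'h) monoid" and \<sigma> where K: "group K" and finK: "finite (carrier K)"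
    and \<sigma>: "\<sigma> \<in> F \<rightarrow> carrier K"
    and rel: "\<And>w. w \<in> words F \<Longrightarrow> length w \<le> B + 1 \<Longrightarrow> word_val K \<sigma> w = \<one>\<^bsub>K\<^esub> \<Longrightarrow>
      word_val H (\<lambda>f. f) w = \<one>\<^bsub>H\<^esub>"
    using finite_permutation_model[OF H.group_axioms F] by metis
  interpret K: group K by (rule K)
  let ?h = "word_val H (\<lambda>f. f)" and ?k = "word_val K \<sigma>"
  have id: "(\<lambda>f. f) \<in> F \<rightarrow> carrier H"
    using F(2) by auto
  note h = H.word_val_closed[OF id] H.word_val_append[OF id] H.word_val_inv[OF id]
  note k = K.word_val_closed[OF \<sigma>] K.word_val_append[OF \<sigma>] K.word_val_inv[OF \<sigma>]
  define cost where "cost w = M + length w + nat \<lceil>N * rho (?h w)\<rceil>" for w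
  define C where "C x = insert B (cost ` {w \<in> words F. ?k w = x})" for x
  \<comment> \<open>The unit is treated separately because all candidates in \<open>C x\<close> are
    positive, even the cost of the empty word.\<close>
  define \<nu> where "\<nu> x = (if x = \<one>\<^bsub>K\<^esub> then 0 else LEAST c. c \<in> C x)" for x

  have \<nu>_le_C: "\<nu> x \<le> c" if "c \<in> C x" for x c
    using that by (simp add: \<nu>_def Least_le)
  have \<nu>_le_B: "\<nu> x \<le> B" for x
    by (rule \<nu>_le_C) (simp add: C_def)
  have \<nu>_le_cost: "\<nu> (?k w) \<le> cost w" if "w \<in> words F" for w
    by (rule \<nu>_le_C) (use that in \<open>auto simp: C_def\<close>)
  have \<nu>_cases: "\<nu> x = B \<or> (\<exists>w\<in>words F. ?k w = x \<and> \<nu> x = cost w)" if "x \<noteq> \<one>\<^bsub>K\<^esub>" for x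
  proof -
    have "(LEAST c. c \<in> C x) \<in> C x"
      by (rule LeastI[of _ B]) (simp add: C_def)
    then show ?thesis
      using that by (auto simp: C_def \<nu>_def)
  qed
  have \<nu>_pos: "0 < \<nu> x" if "x \<noteq> \<one>\<^bsub>K\<^esub>" for x
    using \<nu>_cases[OF that] by (auto simp: B_def cost_def M_def)
  have ceil: "N * rho (?h w) \<le> nat \<lceil>N * rho (?h w)\<rceil>" for w
    by linarith
  have cost_append: "cost (v @ w) \<le> cost v + cost w" if "v \<in> words F" "w \<in> words F" for v w
  proof -
    have "N * rho (?h (v @ w)) \<le> N * (rho (?h v) + rho (?h w))"
      using that h by (intro mult_left_mono) (simp_all add: H.norm_mult)
    then have "N * rho (?h (v @ w)) \<le> real (nat \<lceil>N * rho (?h v)\<rceil> + nat \<lceil>N * rho (?h w)\<rceil>)"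
      using ceil[of v] ceil[of w] by (simp add: distrib_left)
    then show ?thesis
      unfolding cost_def by (simp add: nat_ceiling_le_eq)
  qed
  have cost_inv: "cost (word_inv w) = cost w" if "w \<in> words F" for w
    using that h by (simp add: cost_def H.norm_inv)

  define lam where "lam x = real (\<nu> x) / real N" for x
  have KG: "normed_group K lam"
  proof
    show "0 \<le> lam x" for x
      by (simp add: lam_def)
    show "lam x = 0 \<longleftrightarrow> x = \<one>\<^bsub>K\<^esub>" for x
      using \<nu>_pos[of x] N(2) by (auto simp: lam_def \<nu>_def)
    \<comment> \<open>One inequality suffices: applying it also to the inverse gives
      equality.\<close>
    have inv_le: "\<nu> (inv\<^bsub>K\<^esub> x) \<le> \<nu> x" if "x \<in> carrier K" for x
    proof (cases "x = \<one>\<^bsub>K\<^esub>")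
      case False
      with \<nu>_cases[of x] consider "\<nu> x = B" | w where "w \<in> words F" "?k w = x" "\<nu> x = cost w" by blast
      then show ?thesis
      proof cases
        case (2 w)
        then show ?thesis
          using \<nu>_le_cost[of "word_inv w"] k by (simp add: cost_inv)
      qed (simp add: \<nu>_le_B)
    qed simp
    show "lam (inv\<^bsub>K\<^esub> x) = lam x" if "x \<in> carrier K" for x
      using inv_le[OF that] inv_le[of "inv\<^bsub>K\<^esub> x"] that by (simp add: lam_def)
    show "lam (x \<otimes>\<^bsub>K\<^esub> y) \<le> lam x + lam y" if x: "x \<in> carrier K" and y: "y \<in> carrier K" for x y
    proof -
      have "\<nu> (x \<otimes>\<^bsub>K\<^esub> y) \<le> \<nu> x + \<nu> y"
      proof (cases "x = \<one>\<^bsub>K\<^esub> \<or> y = \<one>\<^bsub>K\<^esub>")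
        case True
        then show ?thesis using x y by auto
      next
        case False
        with \<nu>_cases[of x] \<nu>_cases[of y] consider "\<nu> x = B" | "\<nu> y = B"
          | v w where "v \<in> words F" "?k v = x" "\<nu> x = cost v" "w \<in> words F" "?k w = y" "\<nu> y = cost w"
          by blast
        then show ?thesis
        proof cases
          case (3 v w)
          then show ?thesis
            using \<nu>_le_cost[of "v @ w"] cost_append[of v w] k by simp
        qed (use \<nu>_le_B[of "x \<otimes>\<^bsub>K\<^esub> y"] in simp_all)
      qed
      then show ?thesis
        by (simp add: lam_def divide_right_mono flip: add_divide_distrib of_nat_add)
    qed
  qed
  interpret KG: normed_group K lam by (rule KG)
  have lam_le: "lam x \<le> t \<longleftrightarrow> real (\<nu> x) \<le> N * t" and lam_less: "lam x < t \<longleftrightarrow> real (\<nu> x) < N * t"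
    and lam_ge: "t \<le> lam x \<longleftrightarrow> N * t \<le> real (\<nu> x)" for x and t :: real
    using N(2) by (simp_all add: lam_def field_simps)

  \<comment> \<open>Stating this for a letter \<open>l\<close> covers conjugation by a generator and
    by its inverse at once; \<open>m\<close> stands for the modulus in \<open>H\<close>.\<close>
  have conj: "lam (?k [l] \<otimes>\<^bsub>K\<^esub> x \<otimes>\<^bsub>K\<^esub> inv\<^bsub>K\<^esub> (?k [l])) \<le> 2 * m + \<epsilon> * r"
    if l: "snd l \<in> F" and x: "x \<in> carrier K" "lam x \<le> r" and m: "0 \<le> r" "r \<le> m"
      "\<And>g. g \<in> carrier H \<Longrightarrow> rho g \<le> r \<Longrightarrow> rho (?h [l] \<otimes>\<^bsub>H\<^esub> g \<otimes>\<^bsub>H\<^esub> inv\<^bsub>H\<^esub> (?h [l])) \<le> m"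
    for l x r m
  proof (cases "x = \<one>\<^bsub>K\<^esub>")
    case True
    have "?k [l] \<otimes>\<^bsub>K\<^esub> \<one>\<^bsub>K\<^esub> \<otimes>\<^bsub>K\<^esub> inv\<^bsub>K\<^esub> (?k [l]) = \<one>\<^bsub>K\<^esub>"
      using k(1)[of "[l]"] l by (simp del: word_val.simps)
    then show ?thesis
      using True m \<epsilon> KG.norm_eq_zero_iff[of "\<one>\<^bsub>K\<^esub>"] by (simp del: word_val.simps)
  next
    case False
    have "real (\<nu> (?k [l] \<otimes>\<^bsub>K\<^esub> x \<otimes>\<^bsub>K\<^esub> inv\<^bsub>K\<^esub> (?k [l]))) \<le> N * (m + r + \<epsilon> * r)"
      using \<nu>_cases[OF False]
    proof (elim disjE bexE conjE)
      \<comment> \<open>No conjugate can exceed the cap, so here the norm does not grow.\<close>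
      assume "\<nu> x = B"
      then have "real (\<nu> (?k [l] \<otimes>\<^bsub>K\<^esub> x \<otimes>\<^bsub>K\<^esub> inv\<^bsub>K\<^esub> (?k [l]))) \<le> N * r"
        using \<nu>_le_B[of "?k [l] \<otimes>\<^bsub>K\<^esub> x \<otimes>\<^bsub>K\<^esub> inv\<^bsub>K\<^esub> (?k [l])"] x(2) by (simp add: lam_le del: word_val.simps)
      also have "\<dots> \<le> N * (m + r + \<epsilon> * r)"
        using m(1,2) \<epsilon> by (intro mult_left_mono) simp_all
      finally show ?thesis .
    next
      fix w assume w: "w \<in> words F" "?k w = x" "\<nu> x = cost w"
      have cost_w: "real (M + length w) + nat \<lceil>N * rho (?h w)\<rceil> \<le> N * r"
        using x(2) w(3) by (simp add: lam_le cost_def)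
      then have "N * rho (?h w) \<le> N * r"
        using ceil[of w] by linarith
      then have "rho (?h w) \<le> r"
        using N(2) by simp
      then have "rho (?h ([l] @ w @ word_inv [l])) \<le> m"
        using m(3)[of "?h w"] w(1) l h by (simp add: H.m_assoc del: word_val.simps append.simps)
      then have "N * rho (?h ([l] @ w @ word_inv [l])) \<le> N * m"
        by (simp add: mult_left_mono)
      moreover have "0 \<le> N * m"
        using m(1,2) by simp
      ultimately have "nat \<lceil>N * rho (?h ([l] @ w @ word_inv [l]))\<rceil> \<le> N * m + 1"
        by linarith
      then have "real (cost ([l] @ w @ word_inv [l])) \<le> real (M + length w) + 3 + N * m"
        unfolding cost_def by (simp del: word_val.simps append.simps)
      \<comment> \<open>A nontrivial \<open>x\<close> represented at cost at most
        \<open>N * r\<close> forces \<open>M\<close> to be at most \<open>N * r\<close>, so the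
        choice of \<open>M\<close> absorbs the surplus 3.\<close>
      moreover have "3 \<le> N * (\<epsilon> * r)"
      proof -
        have "real M \<le> N * r"
          using cost_w by linarith
        then have "\<epsilon> * M \<le> \<epsilon> * (N * r)"
          using \<epsilon> by (intro mult_left_mono) simp_all
        then show ?thesis
          using M by (simp add: mult.left_commute)
      qed
      ultimately have cost: "real (cost ([l] @ w @ word_inv [l])) \<le> N * (m + r + \<epsilon> * r)"
        using cost_w by (simp add: distrib_left)
      have "?k [l] \<otimes>\<^bsub>K\<^esub> x \<otimes>\<^bsub>K\<^esub> inv\<^bsub>K\<^esub> (?k [l]) = ?k ([l] @ w @ word_inv [l])"
        using w(1,2) l k x(1) by (simp add: K.m_assoc del: word_val.simps append.simps)
      then have "real (\<nu> (?k [l] \<otimes>\<^bsub>K\<^esub> x \<otimes>\<^bsub>K\<^esub> inv\<^bsub>K\<^esub> (?k [l]))) = real (\<nu> (?k ([l] @ w @ word_inv [l])))"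
        by (simp only:)
      also have "\<dots> \<le> real (cost ([l] @ w @ word_inv [l]))"
        using w(1) l by (intro of_nat_mono \<nu>_le_cost) simp
      also note cost
      finally show ?thesis .
    qed
    then have "lam (?k [l] \<otimes>\<^bsub>K\<^esub> x \<otimes>\<^bsub>K\<^esub> inv\<^bsub>K\<^esub> (?k [l])) \<le> m + r + \<epsilon> * r"
      by (simp only: lam_le)
    \<comment> \<open>The factor 2 arises here: the summand \<open>r\<close>, which pays for offset
      and length, is bounded by \<open>m\<close>.\<close>
    then show ?thesis
      using m(2) by linarith
  qed

  have modulus: "min_modulus K lam (\<sigma> f) r \<le> 2 * min_modulus H rho f r + \<epsilon> * r"
    if f: "f \<in> F" and r: "0 \<le> r" for f r
  proof -
    have fH: "f \<in> carrier H" and fK: "\<sigma> f \<in> carrier K"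
      using f F(2) \<sigma> by auto
    note m = H.min_modulus_ge[OF fH r]
    have "0 \<le> \<epsilon> * r"
      using \<epsilon> r by simp
    then show ?thesis
      using conj[of "(True, f)" _ r "min_modulus H rho f r"]
        conj[of "(False, f)" _ r "min_modulus H rho f r"] m f fH fK r
      by (simp add: KG.min_modulus_le_iff)
  qed

  have lower: "rho f \<le> lam (\<sigma> f)" if f: "f \<in> F" for f
  proof -
    have fH: "f \<in> carrier H" and fK: "\<sigma> f \<in> carrier K"
      using f F(2) \<sigma> by auto
    show ?thesis
    proof (cases "\<sigma> f = \<one>\<^bsub>K\<^esub>")
      case True
      then have "f = \<one>\<^bsub>H\<^esub>"
        using rel[of "[(True, f)]"] f fH by simp
      then show ?thesis
        using H.norm_eq_zero_iff[of f] KG.norm_nonneg[OF fK] fH by simp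
    next
      case False
      from \<nu>_cases[OF False] have "N * rho f \<le> real (\<nu> (\<sigma> f))"
      proof (elim disjE bexE conjE)
        assume "\<nu> (\<sigma> f) = B"
        then show ?thesis using B[OF f] by simp
      next
        fix w assume w: "w \<in> words F" "?k w = \<sigma> f" "\<nu> (\<sigma> f) = cost w"
        show ?thesis
        \<comment> \<open>If \<open>w\<close> is short, \<open>w\<close> followed by the inverse of
          \<open>f\<close> is a relator of \<open>K\<close> within the controlled length, so
          \<open>w\<close> has value \<open>f\<close> in \<open>H\<close>. If \<open>w\<close> is
          long, its length alone exceeds \<open>B\<close>.\<close>
        proof (cases "length w \<le> B")
          case True
          have "?h (w @ [(False, f)]) = \<one>\<^bsub>H\<^esub>"
          proof (rule rel)
            show "?k (w @ [(False, f)]) = \<one>\<^bsub>K\<^esub>"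
              using w f fK by (simp add: k)
          qed (use w f True in simp_all)
          then have "?h w \<otimes>\<^bsub>H\<^esub> inv\<^bsub>H\<^esub> f = \<one>\<^bsub>H\<^esub>"
            using w f fH by (simp add: h)
          then have "?h w = f"
            using H.inv_solve_right'[of "\<one>\<^bsub>H\<^esub>" "?h w" f] h(1)[OF w(1)] fH by simp
          then show ?thesis
            using ceil[of w] w(3) by (simp add: cost_def)
        next
          case False
          then show ?thesis
            using B[OF f] w(3) by (simp add: cost_def)
        qed
      qed
      then show ?thesis
        by (simp only: lam_ge)
    qed
  qed

  have upper: "lam (\<sigma> f) < rho f + \<epsilon>" if f: "f \<in> F" for f
  proof -
    have fH: "f \<in> carrier H" and fK: "\<sigma> f \<in> carrier K"
      using f F(2) \<sigma> by auto
    \<comment> \<open>The word consisting of the single letter \<open>f\<close> gives the upper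
      bound.\<close>
    have "\<nu> (\<sigma> f) \<le> M + 1 + nat \<lceil>N * rho f\<rceil>"
      using \<nu>_le_cost[of "[(True, f)]"] f fH fK by (simp add: cost_def)
    moreover have "nat \<lceil>N * rho f\<rceil> \<le> N * rho f + 1"
      using H.norm_nonneg[OF fH] by (simp add: of_nat_ceiling)
    ultimately have "real (\<nu> (\<sigma> f)) < N * rho f + \<epsilon> * N"
      using N(1) by linarith
    then show ?thesis
      by (simp add: lam_less distrib_left mult.commute)
  qed

  have hom: "lam (inv\<^bsub>K\<^esub> (\<sigma> (f \<otimes>\<^bsub>H\<^esub> g)) \<otimes>\<^bsub>K\<^esub> \<sigma> f \<otimes>\<^bsub>K\<^esub> \<sigma> g) < \<epsilon>"
    if fg: "f \<in> F" "g \<in> F" "f \<otimes>\<^bsub>H\<^esub> g \<in> F" for f g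
  proof -
    have c: "f \<in> carrier H" "g \<in> carrier H" "\<sigma> f \<in> carrier K" "\<sigma> g \<in> carrier K" "\<sigma> (f \<otimes>\<^bsub>H\<^esub> g) \<in> carrier K"
      using fg F(2) \<sigma> by auto
    \<comment> \<open>This relator of \<open>H\<close> has norm 0 there, so only the offset and its
      three letters are paid for.\<close>
    let ?w = "[(False, f \<otimes>\<^bsub>H\<^esub> g), (True, f), (True, g)]"
    have "?h ?w = \<one>\<^bsub>H\<^esub>"
      using c by simp
    then have "cost ?w = M + 3"
      using H.norm_eq_zero_iff[of "\<one>\<^bsub>H\<^esub>"] by (simp add: cost_def)
    moreover have "?k ?w = inv\<^bsub>K\<^esub> (\<sigma> (f \<otimes>\<^bsub>H\<^esub> g)) \<otimes>\<^bsub>K\<^esub> \<sigma> f \<otimes>\<^bsub>K\<^esub> \<sigma> g"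
      using c by (simp add: K.m_assoc)
    ultimately have "\<nu> (inv\<^bsub>K\<^esub> (\<sigma> (f \<otimes>\<^bsub>H\<^esub> g)) \<otimes>\<^bsub>K\<^esub> \<sigma> f \<otimes>\<^bsub>K\<^esub> \<sigma> g) \<le> M + 3"
      using \<nu>_le_cost[of ?w] fg by simp
    then have "real (\<nu> (inv\<^bsub>K\<^esub> (\<sigma> (f \<otimes>\<^bsub>H\<^esub> g)) \<otimes>\<^bsub>K\<^esub> \<sigma> f \<otimes>\<^bsub>K\<^esub> \<sigma> g)) \<le> real (M + 3)"
      by (simp only: of_nat_le_iff)
    then show ?thesis
      using N(1) by (simp add: lam_less mult.commute)
  qed

  have "\<bar>lam (\<sigma> f) - rho f\<bar> < \<epsilon>" if "f \<in> F" for f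
    using lower[OF that] upper[OF that] \<epsilon> by linarith
  then have "eps_homomorphism H rho K lam F \<epsilon> \<sigma>"
    unfolding eps_homomorphism_def using \<sigma> hom by auto
  then have "approximates K lam H rho F \<epsilon>"
    unfolding approximates_def using modulus by blast
  then show thesis
    using that[OF KG finK, of \<nu> N] by (simp add: lam_def)
qed

section \<open>Eventual approximation by one sequence\<close>

lemma eventually_approximates_iff:
  "eventually_approximates G lam H rho \<longleftrightarrow>
    (\<forall>\<epsilon>>0. \<forall>F. finite F \<and> F \<subseteq> carrier H \<longrightarrow>
      (\<exists>i\<^sub>0. \<forall>i\<ge>i\<^sub>0. approximates (G i) (lam i) H rho F \<epsilon>))"
  by (simp add: eventually_approximates_def approximates_def)

text \<open>For given \<open>F\<close> and \<open>\<epsilon>\<close>, a finite \<open>K\<close> with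
  rational norm approximates \<open>H\<close>. It embeds into a code group and thereby into all late
  members of the sequence, with moduli controlled throughout.\<close>

lemma universal_sequence_approximates:
  obtains G :: "nat \<Rightarrow> nat monoid" and lam
  where "finite_normed_groups G lam"
    and "\<And>(H :: 'h monoid) rho. normed_group H rho \<Longrightarrow> eventually_approximates G lam H rho"
proof -
  obtain G :: "nat \<Rightarrow> nat monoid" and lam where G: "finite_normed_groups G lam"
    and emb: "\<And>c. normed_group (code_group c) (code_norm c) \<Longrightarrow>
      \<exists>i\<^sub>0. \<forall>i\<ge>i\<^sub>0. \<exists>\<psi>. modulus_embedding (code_group c) (code_norm c) (G i) (lam i) \<psi>"
    using universal_sequence by metis
  have "eventually_approximates G lam H rho" if H: "normed_group H rho" for H :: "'h monoid" and rho
    unfolding eventually_approximates_iff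
  proof (intro allI impI; elim conjE)
    fix \<epsilon> :: real and F assume "0 < \<epsilon>" "finite F" "F \<subseteq> carrier H"
    then obtain K :: "('h \<Rightarrow> 'h) monoid" and mu \<nu> N where K: "normed_group K mu" "finite (carrier K)"
      "\<And>k. mu k = real (\<nu> k) / real N" and approx: "approximates K mu H rho F \<epsilon>"
      using finite_rational_approximation[OF H] by metis
    obtain c \<psi> where c: "normed_group (code_group c) (code_norm c)"
      "modulus_embedding K mu (code_group c) (code_norm c) \<psi>"
      using rational_norm_coded[OF K] by metis
    show "\<exists>i\<^sub>0. \<forall>i\<ge>i\<^sub>0. approximates (G i) (lam i) H rho F \<epsilon>"
      using emb[OF c(1)] approximates_target[OF c(1)] approximates_target[OF K(1) c approx] G
      unfolding finite_normed_groups_def by meson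
  qed
  with G show thesis
    using that by blast
qed

theorem theorem0p1:
  "(\<exists>(G :: nat \<Rightarrow> nat monoid) lam. finite_normed_groups G lam \<and>
      (\<forall>(H :: 'h monoid) rho. normed_topological_group H rho \<longrightarrow>
        eventually_approximates G lam H rho)) \<and>
   (\<forall>(G :: nat \<Rightarrow> nat monoid) lam. finite_normed_groups G lam \<longrightarrow>
      (\<forall>(H :: nat monoid) rho. normed_topological_group H rho \<longrightarrow>
        eventually_approximates G lam H rho) \<longrightarrow>
      (\<forall>(H :: 'h monoid) rho. normed_topological_group H rho \<longrightarrow>
        eventually_approximates G lam H rho))"
proof (intro conjI allI impI)
  show "\<exists>(G :: nat \<Rightarrow> nat monoid) lam. finite_normed_groups G lam \<and>
      (\<forall>(H :: 'h monoid) rho. normed_topological_group H rho \<longrightarrow>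
        eventually_approximates G lam H rho)"
    using universal_sequence_approximates[where 'h = 'h] normed_topological_group.axioms(1) by metis
next
  \<comment> \<open>Here the sequence is arbitrary, known only to serve groups on
    \<open>nat\<close>; the test set is therefore moved to a group on \<open>nat\<close> that maps
    isometrically into \<open>H\<close>.\<close>
  fix G :: "nat \<Rightarrow> nat monoid" and lam and H :: "'h monoid" and rho
  assume nat: "\<forall>(H :: nat monoid) rho. normed_topological_group H rho \<longrightarrow>
      eventually_approximates G lam H rho"
    and H: "normed_topological_group H rho"
  show "eventually_approximates G lam H rho"
    unfolding eventually_approximates_iff
  proof (intro allI impI; elim conjE)
    fix \<epsilon> :: real and F assume \<epsilon>: "0 < \<epsilon>" and F: "finite F" "F \<subseteq> carrier H"
    obtain H' :: "nat monoid" and rho' \<chi> where H': "normed_topological_group H' rho'"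
      and \<chi>: "isometric_hom H' rho' H rho \<chi>" and F\<chi>: "F \<subseteq> \<chi> ` carrier H'"
      using isometric_hom_nat_covering[OF H countable_finite[OF F(1)] F(2)] by metis
    let ?F = "inv_into (carrier H') \<chi> ` F"
    have "finite ?F" "?F \<subseteq> carrier H'"
      using F(1) F\<chi> by (auto intro: inv_into_into)
    then obtain i\<^sub>0 where "\<And>i. i \<ge> i\<^sub>0 \<Longrightarrow> approximates (G i) (lam i) H' rho' ?F \<epsilon>"
      using nat H' \<epsilon> unfolding eventually_approximates_iff by meson
    then show "\<exists>i\<^sub>0. \<forall>i\<ge>i\<^sub>0. approximates (G i) (lam i) H rho F \<epsilon>"
      using approximates_source[OF _ _ \<chi> F\<chi>] H H' normed_topological_group.axioms(1) by metis
  qed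
qed

end
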